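(* Let $k$ be a positive integer and let $p$ be a prime number such that $p\equiv 2\pmod 3$. Then for every integer $n\ge 0$, $$B_5\left(p^{2k}n+\frac{p^{2k}-1}{3}\right)\equiv(-p^3)^k\cdot B_5(n)\pmod 5.$$
   Context: A partition is called $5$-regular if none of its parts is divisible by $5$. $B_5(n)$ denotes the number of ordered pairs $(\lambda,\mu)$ of $5$-regular partitions such that the sum of all parts of $\lambda$ and $\mu$ equals $n$ (so $B_5(0)=1$); equivalently $\sum_{n\ge 0}B_5(n)q^n=\prod_{k\ge1}\frac{(1-q^{5k})^2}{(1-q^k)^2}$. *)

theory Defs
  imports "HOL-Number_Theory.Number_Theory" "HOL-Library.Multiset"
begin

text \<open>A partition is the multiset of its parts, which are positive integers; the integer
  it partitions is \<^term>\<open>sum_mset\<close> of it.\<close>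

definition is_partition :: "nat multiset \<Rightarrow> bool" where
  "is_partition \<alpha> \<longleftrightarrow> (\<forall>x \<in># \<alpha>. x > 0)"

definition regular_partition :: "nat \<Rightarrow> nat multiset \<Rightarrow> bool" where
  "regular_partition l \<alpha> \<longleftrightarrow> is_partition \<alpha> \<and> (\<forall>x \<in># \<alpha>. \<not> l dvd x)"

definition regular_bipartitions :: "nat \<Rightarrow> nat \<Rightarrow> (nat multiset \<times> nat multiset) set" where
  "regular_bipartitions l n =
     {(\<alpha>, \<beta>). regular_partition l \<alpha> \<and> regular_partition l \<beta> \<and> sum_mset \<alpha> + sum_mset \<beta> = n}"

definition B5 :: "nat \<Rightarrow> nat" where
  "B5 n = card (regular_bipartitions 5 n)"

lemma size_le_sum_mset:
  assumes "is_partition \<alpha>"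
  shows "size \<alpha> \<le> sum_mset \<alpha>"
  using assms by (induction \<alpha>) (auto simp: is_partition_def)

text \<open>The set being counted is finite, so \<^const>\<open>card\<close> is its true cardinality.\<close>

lemma finite_regular_bipartitions: "finite (regular_bipartitions l n)"
proof -
  let ?M = "mset ` {xs. set xs \<subseteq> {..n} \<and> length xs \<le> n}"
  have fin: "finite ?M"
    by (intro finite_imageI finite_lists_length_le) simp
  have mem: "\<alpha> \<in> ?M" if "is_partition \<alpha>" "sum_mset \<alpha> \<le> n" for \<alpha>
  proof -
    obtain xs where xs: "\<alpha> = mset xs" by (metis ex_mset)
    have "length xs \<le> n"
      using size_le_sum_mset[OF that(1)] that(2) unfolding xs size_mset by (rule order_trans)
    moreover have "x \<le> n" if "x \<in> set xs" for x
    proof -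
      have "x \<in># \<alpha>" using that xs by simp
      hence "\<alpha> = add_mset x (\<alpha> - {#x#})" by simp
      hence "sum_mset \<alpha> = x + sum_mset (\<alpha> - {#x#})" by (metis sum_mset.add_mset)
      thus ?thesis using \<open>sum_mset \<alpha> \<le> n\<close> by linarith
    qed
    ultimately show ?thesis unfolding xs by (intro imageI CollectI conjI subsetI; simp)
  qed
  have "regular_bipartitions l n \<subseteq> ?M \<times> ?M"
  proof
    fix z assume "z \<in> regular_bipartitions l n"
    then obtain \<alpha> \<beta> where z: "z = (\<alpha>, \<beta>)" "is_partition \<alpha>" "is_partition \<beta>"
      "sum_mset \<alpha> + sum_mset \<beta> = n"
      unfolding regular_bipartitions_def regular_partition_def by blast
    have "sum_mset \<alpha> \<le> n" "sum_mset \<beta> \<le> n" using z(4) by linarith+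
    hence "\<alpha> \<in> ?M" "\<beta> \<in> ?M" using z(2,3) by (blast intro: mem)+
    thus "z \<in> ?M \<times> ?M" using z(1) by blast
  qed
  thus ?thesis by (rule finite_subset[OF _ finite_cartesian_product[OF fin fin]])
qed

lemma B5_0: "B5 0 = 1"
proof -
  have empty: "\<alpha> = {#}" if "is_partition \<alpha>" "sum_mset \<alpha> = 0" for \<alpha>
    using size_le_sum_mset[OF that(1)] unfolding that(2) le_0_eq size_eq_0_iff_empty .
  have "\<alpha> = {#} \<and> \<beta> = {#}" if "(\<alpha>, \<beta>) \<in> regular_bipartitions 5 0" for \<alpha> \<beta>
  proof -
    have "is_partition \<alpha>" "is_partition \<beta>" and s: "sum_mset \<alpha> + sum_mset \<beta> = 0"
      using that unfolding regular_bipartitions_def regular_partition_def mem_Collect_eq prod.case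
      by blast+
    moreover have "sum_mset \<alpha> = 0" "sum_mset \<beta> = 0"
      using s unfolding add_is_0 by blast+
    ultimately show ?thesis using empty by blast
  qed
  moreover have "({#}, {#}) \<in> regular_bipartitions 5 0"
    unfolding regular_bipartitions_def regular_partition_def is_partition_def by simp
  ultimately have "regular_bipartitions 5 0 = {({#}, {#})}" by fast
  thus ?thesis unfolding B5_def by simp
qed

end

theory Submission
  imports Defs "HOL-Computational_Algebra.Formal_Power_Series"
    "HOL-Computational_Algebra.Polynomial"
begin

text \<open>Write \<open>f\<close> for Euler's product \<open>\<Prod>k\<ge>1. 1 - q ^ k\<close>. Modulo 5 the generating function of \<open>B5\<close> is
  \<open>f ^ 8\<close>, which is the theta series of a Hecke character of \<open>\<int>[\<omega>]\<close>, \<open>\<omega>\<close> a primitive cube root of unity: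
  \<open>6 * f ^ 8\<close> is the sum over \<open>u + v \<equiv> 1\<close> modulo 3 of \<open>(2 u - v) (2 v - u) (- u - v) q ^ ((N - 1) / 3)\<close>
  with \<open>N = u ^ 2 - u v + v ^ 2\<close>. Since a prime \<open>p \<equiv> 2\<close> modulo 3 is inert, \<open>p\<close> divides \<open>N\<close> only if it divides
  \<open>u\<close> and \<open>v\<close>, and the claim follows by substituting \<open>(- p u, - p v)\<close> for \<open>(u, v)\<close>.

  The theta expansion is a Macdonald identity for \<open>A\<^sub>2\<close>. By Jacobi, \<open>- (f ^ 3)\<close> is the sum of
  \<open>(-1) ^ a * a * q ^ (a (a - 1) / 2)\<close> over all integers \<open>a\<close>; inserting the cubic above at \<open>u = a - c\<close>, \<open>v = b - c\<close>
  into the corresponding triple sum yields \<open>- 12 * f ^ 9\<close>. For fixed \<open>u\<close> and \<open>v\<close> the remaining sum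
  along the diagonal is, up to sign and a power of \<open>q\<close>, either 0 or Euler's pentagonal series, that is \<open>f\<close>.\<close>

section \<open>The finite Jacobi triple product\<close>

definition qpoch :: "'a::comm_ring_1 \<Rightarrow> nat \<Rightarrow> 'a" where
  "qpoch q n = (\<Prod>i<n. 1 - q ^ Suc i)"

lemma qpoch_0 [simp]: "qpoch q 0 = 1"
  and qpoch_Suc: "qpoch q (Suc n) = qpoch q n * (1 - q ^ Suc n)"
  by (simp_all add: qpoch_def)

text \<open>The Gaussian binomial coefficient, given by its Pascal recurrence because the usual
  quotient of \<open>qpoch\<close> values needs division.\<close>

fun qbinomial :: "'a::comm_ring_1 \<Rightarrow> nat \<Rightarrow> nat \<Rightarrow> 'a" where
  "qbinomial q n 0 = 1"
| "qbinomial q 0 (Suc k) = 0"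
| "qbinomial q (Suc n) (Suc k) = qbinomial q n k + q ^ Suc k * qbinomial q n (Suc k)"

lemma qbinomial_eq_0: "n < k \<Longrightarrow> qbinomial q n k = 0"
  by (induction q n k rule: qbinomial.induct) auto

text \<open>Multiplying the Pascal recurrence by the denominators reduces the induction step to
  \<open>(1 - q ^ a) + q ^ a * (1 - q ^ b) = 1 - q ^ (a + b)\<close>.\<close>

lemma qbinomial_qpoch: "qbinomial q (a + b) a * (qpoch q a * qpoch q b) = qpoch q (a + b)"
proof (induction "a + b" arbitrary: a b)
  case 0
  thus ?case by simp
next
  case (Suc n)
  show ?case
  proof (cases a)
    case 0
    thus ?thesis by simp
  next
    case [simp]: (Suc a')
    have n: "n = a' + b" using Suc.hyps(2) by simp
    have IH1: "qbinomial q (a' + b) a' * (qpoch q a' * qpoch q b) = qpoch q (a' + b)"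
      using Suc.hyps(1)[OF n] .
    \<comment> \<open>For \<open>b = 0\<close>, where \<open>b\<close> has no predecessor to induct
      on, both sides vanish.\<close>
    have IH2: "qbinomial q (a' + b) (Suc a') * (qpoch q (Suc a') * qpoch q b)
        = (1 - q ^ b) * qpoch q (a' + b)"
    proof (cases b)
      case 0
      thus ?thesis by (simp add: qbinomial_eq_0)
    next
      case (Suc b')
      have "n = Suc a' + b'" using n Suc by simp
      from Suc.hyps(1)[OF this]
      have "(1 - q ^ b) * qpoch q (a' + b)
          = (1 - q ^ b) * (qbinomial q (a' + b) (Suc a') * (qpoch q (Suc a') * qpoch q b'))"
        by (simp add: Suc)
      thus ?thesis by (simp only: Suc qpoch_Suc[of q b'] mult_ac)
    qed
    have "qbinomial q (a + b) a * (qpoch q a * qpoch q b)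
        = (1 - q ^ Suc a') * (qbinomial q (a' + b) a' * (qpoch q a' * qpoch q b))
        + q ^ Suc a' * (qbinomial q (a' + b) (Suc a') * (qpoch q (Suc a') * qpoch q b))"
      by (simp add: qpoch_Suc algebra_simps)
    also have "\<dots> = qpoch q (a + b)"
      unfolding IH1 IH2 by (simp add: qpoch_Suc power_add algebra_simps)
    finally show ?thesis .
  qed
qed

lemma choose_two_Suc: "Suc k choose 2 = k + (k choose 2)"
  by (simp add: numeral_2_eq_2)

text \<open>Splitting off the factor \<open>i = 0\<close> turns \<open>y\<close> into
  \<open>y * q\<close> in the rest, hence the induction over arbitrary \<open>y\<close>. The
  variable \<open>z\<close> makes the identity homogeneous, so that \<open>z = q ^ n\<close> can be
  inserted without negative powers of \<open>q\<close>.\<close>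

lemma qbinomial_theorem:
  "(\<Prod>i<n. z - y * q ^ i) = (\<Sum>k\<le>n. (-1) ^ k * q ^ (k choose 2) * qbinomial q n k * y ^ k * z ^ (n - k))"
proof (induction n arbitrary: y)
  case 0
  thus ?case by (simp add: numeral_2_eq_2)
next
  case (Suc n)
  define A where "A k = (-1) ^ k * q ^ (k choose 2) * q ^ k * y ^ k" for k
  have "(\<Prod>i<Suc n. z - y * q ^ i) = (z - y) * (\<Prod>i<n. z - (y * q) * q ^ i)"
    by (simp add: prod.lessThan_Suc_shift mult_ac del: prod.lessThan_Suc)
  also have "\<dots> = (z - y) * (\<Sum>k\<le>n. A k * qbinomial q n k * z ^ (n - k))"
    by (subst Suc.IH) (simp add: A_def power_mult_distrib mult_ac)
  also have "\<dots> = (\<Sum>k\<le>n. A k * qbinomial q n k * z ^ (Suc n - k))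
       - y * (\<Sum>k\<le>n. A k * qbinomial q n k * z ^ (n - k))"
    unfolding sum_distrib_left sum_subtractf[symmetric]
    by (intro sum.cong) (auto simp: Suc_diff_le algebra_simps)
  also have "(\<Sum>k\<le>n. A k * qbinomial q n k * z ^ (Suc n - k)) =
       (\<Sum>k\<le>Suc n. A k * qbinomial q n k * z ^ (Suc n - k))"
    by (simp add: qbinomial_eq_0)
  also have "\<dots> = z ^ Suc n + (\<Sum>k\<le>n. A (Suc k) * qbinomial q n (Suc k) * z ^ (n - k))"
    by (subst sum.atMost_Suc_shift) (simp add: A_def binomial_eq_0)
  also have "z ^ Suc n + (\<Sum>k\<le>n. A (Suc k) * qbinomial q n (Suc k) * z ^ (n - k))
      - y * (\<Sum>k\<le>n. A k * qbinomial q n k * z ^ (n - k))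
      = z ^ Suc n + (\<Sum>k\<le>n. (A (Suc k) * qbinomial q n (Suc k) - y * A k * qbinomial q n k) * z ^ (n - k))"
    by (simp add: sum_subtractf sum_distrib_left algebra_simps)
  also have "\<dots> = z ^ Suc n + (\<Sum>k\<le>n. (-1) ^ Suc k * q ^ (Suc k choose 2) * qbinomial q (Suc n) (Suc k)
      * y ^ Suc k * z ^ (n - k))"
    by (intro arg_cong2[where f = "(+)"] sum.cong refl)
       (simp add: A_def choose_two_Suc power_add algebra_simps)
  also have "\<dots> = (\<Sum>k\<le>Suc n. (-1) ^ k * q ^ (k choose 2) * qbinomial q (Suc n) k * y ^ k * z ^ (Suc n - k))"
    by (subst sum.atMost_Suc_shift) (simp add: binomial_eq_0 del: qbinomial.simps(3))
  finally show ?case .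
qed

definition tri :: "int \<Rightarrow> nat" where
  "tri a = nat (a * (a - 1) div 2)"

lemma tri_double: "2 * int (tri a) = a * (a - 1)"
proof -
  have "0 \<le> a * (a - 1)" by (cases "a \<le> 0") (auto simp: zero_le_mult_iff)
  moreover have "even (a * (a - 1))" by auto
  ultimately show ?thesis by (simp add: tri_def)
qed

lemma finite_jacobi_triple:
  fixes q x :: "'a::idom"
  assumes "q \<noteq> 0"
  shows "(\<Prod>i<n. (q ^ Suc i - x) * (1 - x * q ^ i)) =
    (\<Sum>k\<le>2 * n. (-1) ^ k * q ^ tri (int k - int n) * qbinomial q (2 * n) k * x ^ k)"
proof -
  \<comment> \<open>This is the \<open>q\<close>-binomial theorem with \<open>2 n\<close> factors at \<open>z = q ^ n\<close>, divided by \<open>q ^ E\<close>.\<close>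
  define E where "E = (n choose 2) + n * n"
  have "(\<Prod>i<2 * n. q ^ n - x * q ^ i) =
     (\<Prod>i<n. q ^ n - x * q ^ i) * (\<Prod>i<n. q ^ n - x * q ^ (n + i))"
    by (simp add: mult_2 lessThan_atLeast0 flip: prod.atLeastLessThan_concat[of 0 n "n+n"])
       (simp add: atLeast0LessThan add.commute prod.shift_bounds_nat_ivl[of _ 0 n n, simplified])
  also have "(\<Prod>i<n. q ^ n - x * q ^ i) = (\<Prod>i<n. q ^ i * (q ^ (n - i) - x))"
    by (intro prod.cong) (auto simp: algebra_simps simp flip: power_add)
  also have "\<dots> = q ^ (n choose 2) * (\<Prod>i<n. q ^ (n - i) - x)"
  proof -
    have "(\<Prod>i<n. q ^ i) = q ^ (n choose 2)"
      by (induction n) (auto simp: choose_two_Suc binomial_eq_0 power_add mult_ac)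
    thus ?thesis by (simp add: prod.distrib)
  qed
  also have "(\<Prod>i<n. q ^ (n - i) - x) = (\<Prod>i<n. q ^ Suc i - x)"
    by (subst prod.nat_diff_reindex[symmetric]) (auto intro!: prod.cong simp flip: power_Suc simp: Suc_diff_Suc)
  also have "(\<Prod>i<n. q ^ n - x * q ^ (n + i)) = (\<Prod>i<n. q ^ n * (1 - x * q ^ i))"
    by (intro prod.cong) (auto simp: algebra_simps power_add)
  also have "\<dots> = q ^ (n * n) * (\<Prod>i<n. 1 - x * q ^ i)"
    by (simp add: prod.distrib power_mult)
  finally have L: "(\<Prod>i<2 * n. q ^ n - x * q ^ i) = q ^ E * (\<Prod>i<n. (q ^ Suc i - x) * (1 - x * q ^ i))"
    by (simp add: E_def power_add prod.distrib mult_ac)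
  \<comment> \<open>After doubling, both sides are 4 n^2 + k^2 - 2 k n - k.\<close>
  have ex: "(k choose 2) + n * (2 * n - k) = E + tri (int k - int n)" if "k \<le> 2 * n" for k
  proof -
    have ch: "2 * int (m choose 2) = int m * (int m - 1)" for m
      by (induction m) (auto simp: choose_two_Suc binomial_eq_0 algebra_simps)
    have "2 * int ((k choose 2) + n * (2 * n - k)) = 2 * int (E + tri (int k - int n))"
      using that ch[of k] ch[of n] tri_double[of "int k - int n"]
      by (simp only: E_def of_nat_add of_nat_mult of_nat_diff of_nat_numeral) (simp add: algebra_simps)
    thus ?thesis by (metis mult_cancel_left of_nat_eq_iff zero_neq_numeral)
  qed
  have "q ^ E * (\<Prod>i<n. (q ^ Suc i - x) * (1 - x * q ^ i)) =
     (\<Sum>k\<le>2*n. (-1) ^ k * q ^ (k choose 2) * qbinomial q (2*n) k * x ^ k * (q ^ n) ^ (2*n - k))"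
    unfolding L[symmetric] by (rule qbinomial_theorem)
  also have "\<dots> = (\<Sum>k\<le>2*n. q ^ E * ((-1) ^ k * q ^ tri (int k - int n) * qbinomial q (2 * n) k * x ^ k))"
  proof (intro sum.cong refl)
    fix k assume "k \<in> {..2 * n}"
    hence "q ^ (k choose 2) * (q ^ n) ^ (2*n - k) = q ^ E * q ^ tri (int k - int n)"
      using ex[of k] by (simp flip: power_mult power_add)
    hence "(q ^ (k choose 2) * (q ^ n) ^ (2*n - k)) * ((-1) ^ k * qbinomial q (2*n) k * x ^ k)
      = (q ^ E * q ^ tri (int k - int n)) * ((-1) ^ k * qbinomial q (2*n) k * x ^ k)" by simp
    thus "(-1) ^ k * q ^ (k choose 2) * qbinomial q (2*n) k * x ^ k * (q ^ n) ^ (2*n - k) =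
      q ^ E * ((-1) ^ k * q ^ tri (int k - int n) * qbinomial q (2 * n) k * x ^ k)"
      by (simp only: mult_ac)
  qed
  also have "\<dots> = q ^ E * (\<Sum>k\<le>2*n. (-1) ^ k * q ^ tri (int k - int n) * qbinomial q (2 * n) k * x ^ k)"
    by (simp only: sum_distrib_left)
  finally show ?thesis using assms by simp
qed

text \<open>The sign (-1)^a for integers a, negative ones included, in any commutative ring.\<close>

definition alt :: "int \<Rightarrow> 'a::comm_ring_1" where
  "alt a = (if even a then 1 else -1)"

lemma alt_add: "alt (a + b) = alt a * alt b"
  by (auto simp: alt_def)

lemma of_int_alt [simp]: "of_int (alt a) = alt a"
  by (simp add: alt_def)

lemma alt_of_nat_diff: "alt (int k - int n) = (-1) ^ n * (-1) ^ k"
  by (auto simp: alt_def)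

lemma sum_shift_centred: "(\<Sum>k\<le>2 * n. f k) = (\<Sum>j\<in>{- int n..int n}. f (nat (int n + j)))"
  by (rule sum.reindex_bij_witness[where i = "\<lambda>j. nat (int n + j)" and j = "\<lambda>k. int k - int n"]) auto

corollary finite_jacobi_triple_centred:
  fixes q x :: "'a::idom"
  assumes "q \<noteq> 0"
  shows "(\<Prod>i<n. (q ^ Suc i - x) * (1 - x * q ^ i)) =
    (-1) ^ n * (\<Sum>j\<in>{- int n..int n}. alt j * q ^ tri j * qbinomial q (2 * n) (nat (int n + j)) * x ^ nat (int n + j))"
proof -
  have "(-1) ^ nat (int n + j) = (-1) ^ n * (alt j :: 'a)" if "j \<in> {- int n..int n}" for j
    using alt_of_nat_diff[of "nat (int n + j)" n, where 'a='a] that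
    by (simp flip: mult.assoc power_mult_distrib)
  thus ?thesis unfolding finite_jacobi_triple[OF assms] sum_shift_centred sum_distrib_left
    by (intro sum.cong refl) (simp add: mult_ac)
qed

lemma finite_jacobi_derivative:
  fixes q :: "'a::idom"
  assumes "q \<noteq> 0" "n > 0"
  shows "(\<Sum>j\<in>{- int n..int n}. alt j * of_int j * q ^ tri j * qbinomial q (2 * n) (nat (int n + j)))
    = - (qpoch q n * qpoch q (n - 1))"
proof -
  obtain n' where n: "n = Suc n'" using assms(2) by (cases n) auto
  \<comment> \<open>The triple product is applied over polynomials, at the constant
    \<open>[:q:]\<close> and the indeterminate \<open>[:0, 1:]\<close>; its q-binomials are then
    constants.\<close>
  have qbinomial_hom: "qbinomial [:q:] a b = [:qbinomial q a b:]" for a b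
    by (induction q a b rule: qbinomial.induct) (auto simp: poly_const_pow simp flip: one_pCons)
  \<comment> \<open>Differentiate the triple product at \<open>x = 1\<close>, where its factor \<open>1 - x\<close> vanishes.\<close>
  define c where "c j = alt j * q ^ tri j * qbinomial q (2 * n) (nat (int n + j))" for j
  \<comment> \<open>\<open>R\<close> is the triple product without the factor \<open>1 - x\<close>,
    which comes from \<open>i = 0\<close> in the second family.\<close>
  define R where "R = (\<Prod>i<n. [:q ^ Suc i, -1:]) * (\<Prod>i<n'. [:1, - (q ^ Suc i):])"
  define S where "S = (\<Sum>j\<in>{- int n..int n}. monom (c j) (nat (int n + j)))"
  have "[:1, -1:] * R = (\<Prod>i<n. [:q ^ Suc i, -1:]) * (\<Prod>i<n. [:1, - (q ^ i):])"
    unfolding n R_def prod.lessThan_Suc_shift[of "\<lambda>i. [:1, - (q ^ i):]"] power_0 by (simp only: mult_ac)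
  also have "\<dots> = (\<Prod>i<n. ([:q:] ^ Suc i - [:0, 1:]) * (1 - [:0, 1:] * [:q:] ^ i))"
    unfolding prod.distrib by (simp add: poly_const_pow one_pCons mult.commute[of q])
  also have "\<dots> = (-1) ^ n * S"
  proof (subst finite_jacobi_triple_centred)
    have "alt j * [:q:] ^ tri j * qbinomial [:q:] (2 * n) (nat (int n + j)) * [:0, 1:] ^ nat (int n + j)
      = monom (c j) (nat (int n + j))" for j
      unfolding qbinomial_hom c_def monom_altdef poly_const_pow alt_def by (simp add: one_pCons mult_ac)
    thus "(-1) ^ n * (\<Sum>j\<in>{- int n..int n}. alt j * [:q:] ^ tri j * qbinomial [:q:] (2 * n) (nat (int n + j)) *
       [:0, 1:] ^ nat (int n + j)) = (-1) ^ n * S"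
      by (simp add: S_def)
  qed (use assms in simp)
  finally have "(-1) ^ n * ([:1, -1:] * R) = (-1) ^ n * ((-1) ^ n * S)" by simp
  hence S: "S = (-1) ^ n * ([:1, -1:] * R)"
    by (simp flip: mult.assoc power_mult_distrib)
  have S0: "(\<Sum>j\<in>{- int n..int n}. c j) = 0"
  proof -
    have "poly S 1 = 0" unfolding S by simp
    thus ?thesis by (simp add: S_def poly_sum poly_monom)
  qed
  have R1: "poly R 1 = (-1) ^ n * (qpoch q n * qpoch q n')"
  proof -
    have "(\<Prod>i<n. q ^ Suc i - 1) = (\<Prod>i<n. (-1) * (1 - q ^ Suc i))" by simp
    thus ?thesis by (simp only: R_def poly_mult poly_prod prod.distrib) (simp add: qpoch_def)
  qed
  have pderiv_sum: "pderiv (sum f A) = (\<Sum>j\<in>A. pderiv (f j))" for f :: "int \<Rightarrow> 'a poly" and A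
    by (induction A rule: infinite_finite_induct) (auto simp: pderiv_add)
  \<comment> \<open>Differentiation produces the weight \<open>n + j\<close> instead of
    \<open>j\<close>; the excess is \<open>n\<close> times the sum \<open>S0\<close>, which is
    0.\<close>
  have "(\<Sum>j\<in>{- int n..int n}. c j * of_int j) = (\<Sum>j\<in>{- int n..int n}. c j * of_nat (nat (int n + j)))
     - of_nat n * (\<Sum>j\<in>{- int n..int n}. c j)"
    unfolding sum_distrib_left sum_subtractf[symmetric] by (intro sum.cong) (auto simp: algebra_simps)
  also have "\<dots> = poly (pderiv S) 1"
    unfolding S0 by (simp add: S_def pderiv_sum poly_sum pderiv_monom poly_monom mult_ac)
  \<comment> \<open>By the product rule the derivative of \<open>(1 - x) * R\<close> at 1 is minus
    the value of \<open>R\<close> there.\<close>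
  also have "\<dots> = - ((-1) ^ n * poly R 1)"
  proof -
    have e: "(-1) ^ n = [:(-1) ^ n :: 'a:]" by (metis poly_const_pow one_pCons minus_pCons minus_zero)
    show ?thesis unfolding S e by (simp add: pderiv_smult pderiv_add pderiv_minus pderiv_pCons)
  qed
  also have "\<dots> = - (qpoch q n * qpoch q (n - 1))"
    unfolding R1 n by (simp flip: mult.assoc power_mult_distrib)
  finally show ?thesis by (simp add: c_def mult_ac)
qed

section \<open>Congruences of power series\<close>

text \<open>One relation for two purposes: modulo a power of \<open>fps_X\<close> it compares
  truncations, modulo \<open>of_int 5\<close> it compares coefficients modulo 5.\<close>

definition congr :: "'a::comm_ring_1 \<Rightarrow> 'a \<Rightarrow> 'a \<Rightarrow> bool" where
  "congr m a b \<longleftrightarrow> m dvd a - b"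

lemma congr_refl [simp]: "congr m a a"
  by (simp add: congr_def)

lemma congr_sym: "congr m a b \<Longrightarrow> congr m b a"
  unfolding congr_def by (metis minus_diff_eq dvd_minus_iff)

lemma congr_trans [trans]: "congr m a b \<Longrightarrow> congr m b c \<Longrightarrow> congr m a c"
  unfolding congr_def using dvd_add[of m "a - b" "b - c"] by simp

lemma congr_mult: "congr m a b \<Longrightarrow> congr m c d \<Longrightarrow> congr m (a * c) (b * d)"
proof -
  assume "congr m a b" "congr m c d"
  hence "m dvd (a - b) * c + b * (c - d)" by (auto simp: congr_def)
  thus ?thesis by (simp add: congr_def algebra_simps)
qed

lemma congr_sum: "(\<And>i. i \<in> I \<Longrightarrow> congr m (f i) (g i)) \<Longrightarrow> congr m (sum f I) (sum g I)"
  unfolding congr_def sum_subtractf[symmetric] by (rule dvd_sum)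

lemma congr_prod: "(\<And>i. i \<in> I \<Longrightarrow> congr m (f i) (g i)) \<Longrightarrow> congr m (prod f I) (prod g I)"
  by (induction I rule: infinite_finite_induct) (auto intro: congr_mult)

lemma congr_power: "congr m a b \<Longrightarrow> congr m (a ^ n) (b ^ n)"
  by (induction n) (auto intro: congr_mult)

lemma congr_weaken: "congr m a b \<Longrightarrow> n dvd m \<Longrightarrow> congr n a b"
  by (auto simp: congr_def intro: dvd_trans)

lemma congr_fps_X_power: "congr (fps_X ^ N) f g \<longleftrightarrow> (\<forall>i<N. fps_nth f i = fps_nth g i)"
proof
  assume "congr (fps_X ^ N) f g"
  then obtain h where h: "f - g = fps_X ^ N * h" by (auto simp: congr_def)
  show "\<forall>i<N. fps_nth f i = fps_nth g i"
  proof safe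
    fix i assume "i < N"
    hence "fps_nth (f - g) i = 0" unfolding h by (simp add: fps_X_power_mult_nth)
    thus "fps_nth f i = fps_nth g i" by simp
  qed
next
  assume "\<forall>i<N. fps_nth f i = fps_nth g i"
  hence "f - g = fps_X ^ N * fps_shift N (f - g)"
    by (auto simp: fps_eq_iff fps_X_power_mult_nth)
  thus "congr (fps_X ^ N) f g" unfolding congr_def by (metis dvd_triv_left)
qed

lemma congr_of_int_fps: "congr (of_int m) f g \<longleftrightarrow> (\<forall>i. m dvd fps_nth f i - fps_nth g i)"
proof
  assume "congr (of_int m) f g"
  then obtain h where "f - g = of_int m * h" by (auto simp: congr_def)
  hence "fps_nth (f - g) i = m * fps_nth h i" for i
    by (simp add: fps_of_int[symmetric] del: fps_sub_nth)
  thus "\<forall>i. m dvd fps_nth f i - fps_nth g i" by simp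
next
  assume "\<forall>i. m dvd fps_nth f i - fps_nth g i"
  hence "f - g = of_int m * Abs_fps (\<lambda>i. (fps_nth f i - fps_nth g i) div m)"
    by (simp add: fps_eq_iff fps_of_int[symmetric])
  thus "congr (of_int m) f g" unfolding congr_def by (metis dvd_triv_left)
qed

section \<open>Limits of q-Pochhammer symbols and central q-binomials\<close>

lemma qpoch_congr:
  assumes "m \<le> i"
  shows "congr (q ^ Suc m) (qpoch q i) (qpoch q m)"
  using assms
proof (induction i rule: dec_induct)
  case (step i)
  have "congr (q ^ Suc m) (1 - q ^ Suc i) 1"
    using step by (auto simp: congr_def intro!: le_imp_power_dvd simp del: power_Suc)
  from congr_mult[OF step.IH this] show ?case by (simp add: qpoch_Suc)
qed simp

text \<open>\<open>qpoch q m\<close> has the form \<open>1 - q * t\<close>, a unit modulo every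
  power of \<open>q\<close>. Concretely, if \<open>q ^ N\<close> divides \<open>c\<close>, then
  \<open>q ^ Suc N\<close> divides \<open>q * t * c\<close>, and adding this to
  \<open>(1 - q * t) * c\<close> leaves \<open>c\<close>.\<close>

lemma congr_qpoch_cancel:
  assumes "congr (q ^ N) (qpoch q m * a) (qpoch q m * b)"
  shows "congr (q ^ N) a b"
proof -
  obtain t where t: "qpoch q m = 1 - q * t"
  proof -
    have "congr q (qpoch q m) 1"
      using qpoch_congr[of 0 m q] by simp
    hence "q dvd 1 - qpoch q m" using congr_sym unfolding congr_def by blast
    then obtain t where "1 - qpoch q m = q * t" by blast
    hence "qpoch q m = 1 - q * t" by (metis diff_diff_eq2 add_diff_cancel_left')
    thus ?thesis by (rule that)
  qed
  define c where "c = a - b"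
  have "q ^ N dvd (1 - q * t) * c"
    using assms by (simp add: congr_def c_def t right_diff_distrib)
  hence "q ^ N dvd c"
  proof (induction N)
    case (Suc N)
    have "q ^ N dvd c"
      by (rule Suc.IH[OF dvd_trans[OF le_imp_power_dvd Suc.prems]]) simp
    hence "q ^ Suc N dvd q * t * c"
      unfolding power_Suc mult.assoc by (intro mult_dvd_mono dvd_refl dvd_mult)
    with Suc.prems have "q ^ Suc N dvd (1 - q * t) * c + q * t * c" by (rule dvd_add)
    thus ?case by (simp add: algebra_simps)
  qed simp
  thus ?thesis by (simp add: congr_def c_def)
qed

text \<open>Both \<open>n + j\<close> and \<open>n - j\<close> are at least
  \<open>m = n - |j|\<close>, so modulo \<open>q ^ Suc m\<close> every q-Pochhammer symbol involved
  may be replaced by \<open>qpoch q m\<close> and then cancelled.\<close>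

lemma qbinomial_central_congr:
  assumes "j \<in> {- int n..int n}"
  shows "congr (q ^ (Suc n - nat \<bar>j\<bar>)) (qbinomial q (2 * n) (nat (int n + j)) * qpoch q n) 1"
proof -
  define m where "m = n - nat \<bar>j\<bar>"
  define k where "k = nat (int n + j)"
  define l where "l = nat (int n - j)"
  have eq: "k + l = 2 * n" "Suc n - nat \<bar>j\<bar> = Suc m" and le: "m \<le> k" "m \<le> l" "m \<le> 2 * n" "m \<le> n"
    using assms by (auto simp: m_def k_def l_def)
  let ?B = "qbinomial q (2 * n) k" and ?P = "qpoch q m"
  have "congr (q ^ Suc m) (?B * (?P * ?P)) (?B * (qpoch q k * qpoch q l))"
    by (intro congr_mult congr_refl congr_sym[OF qpoch_congr] le)
  also have "?B * (qpoch q k * qpoch q l) = qpoch q (2 * n)"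
    using qbinomial_qpoch[of q k l] by (simp add: eq)
  also have "congr (q ^ Suc m) (qpoch q (2 * n)) ?P"
    by (intro qpoch_congr le)
  finally have "congr (q ^ Suc m) (?P * (?B * ?P)) (?P * 1)" by (simp add: mult_ac)
  hence "congr (q ^ Suc m) (?B * ?P) 1" by (rule congr_qpoch_cancel)
  moreover have "congr (q ^ Suc m) (?B * qpoch q n) (?B * ?P)"
    by (intro congr_mult congr_refl qpoch_congr le)
  ultimately show ?thesis unfolding eq k_def[symmetric] by (blast intro: congr_trans)
qed

section \<open>The identities of Euler and Jacobi\<close>

text \<open>Euler's infinite product, read off the diagonal: factors beyond the n-th do not affect
  coefficient n.\<close>

definition euler_fps :: "int fps" where
  "euler_fps = Abs_fps (\<lambda>n. fps_nth (qpoch fps_X n) n)"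

lemma qpoch_fps_X_congr: "congr (fps_X ^ Suc n) (qpoch fps_X n) euler_fps"
  unfolding congr_fps_X_power
proof safe
  fix i assume "i < Suc n"
  hence "congr (fps_X ^ Suc i :: int fps) (qpoch fps_X n) (qpoch fps_X i)"
    by (intro qpoch_congr) simp
  thus "fps_nth (qpoch fps_X n) i = fps_nth euler_fps i"
    unfolding congr_fps_X_power by (simp add: euler_fps_def)
qed

lemma euler_fps_nth_0 [simp]: "fps_nth euler_fps 0 = 1"
  by (simp add: euler_fps_def)

lemma euler_fps_nonzero [simp]: "euler_fps \<noteq> 0"
  using euler_fps_nth_0 by fastforce

text \<open>The power series \<open>\<Sum>i\<in>I. c i * q ^ e i\<close>; it only makes sense if \<open>e\<close> has finite fibres,
  since \<^const>\<open>sum\<close> is \<open>0\<close> on infinite sets.\<close>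

definition gf :: "'i set \<Rightarrow> ('i \<Rightarrow> nat) \<Rightarrow> ('i \<Rightarrow> int) \<Rightarrow> int fps" where
  "gf I e c = Abs_fps (\<lambda>n. \<Sum>i\<in>{i\<in>I. e i = n}. c i)"

lemma gf_nth: "fps_nth (gf I e c) n = (\<Sum>i\<in>{i\<in>I. e i = n}. c i)"
  by (simp add: gf_def)

lemma gf_congr_sum:
  assumes "finite J" "J \<subseteq> I" "\<And>i. i \<in> I \<Longrightarrow> e i < N \<Longrightarrow> i \<in> J"
  shows "congr (fps_X ^ N) (gf I e c) (\<Sum>i\<in>J. of_int (c i) * fps_X ^ e i)"
  unfolding congr_fps_X_power
proof safe
  fix n assume n: "n < N"
  have "fps_nth (\<Sum>i\<in>J. of_int (c i) * fps_X ^ e i) n = (\<Sum>i\<in>J. if e i = n then c i else 0)"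
    by (auto simp: fps_sum_nth fps_of_int[symmetric] intro!: sum.cong)
  also have "\<dots> = (\<Sum>i\<in>{i\<in>J. e i = n}. c i)"
    using assms(1) by (simp add: sum.inter_filter)
  also have "{i\<in>J. e i = n} = {i\<in>I. e i = n}" using assms n by auto
  finally show "fps_nth (gf I e c) n = fps_nth (\<Sum>i\<in>J. of_int (c i) * fps_X ^ e i) n"
    by (simp add: gf_nth)
qed

text \<open>A factor known to be 1 only up to precision \<open>a\<close> is harmless to order
  \<open>a + b\<close> next to \<open>q ^ b\<close>. This handles the terms far from the centre in
  the limits below.\<close>

lemma congr_power_mult:
  assumes "congr (q ^ a) u 1" "N \<le> b + a"
  shows "congr (q ^ N) (c * q ^ b) (c * (q ^ b * u))"
proof -
  have "q ^ b * q ^ a dvd q ^ b * (1 - u)"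
    using congr_sym[OF assms(1)] by (intro mult_dvd_mono dvd_refl) (simp add: congr_def)
  hence "q ^ (b + a) dvd c * (q ^ b * (1 - u))"
    unfolding power_add by (rule dvd_mult)
  hence "q ^ N dvd c * (q ^ b * (1 - u))"
    by (rule dvd_trans[OF le_imp_power_dvd[OF assms(2)]])
  thus ?thesis by (simp add: congr_def right_diff_distrib)
qed

text \<open>Linear growth suffices: it makes the fibres of \<open>tri\<close> and
  \<open>pent\<close> finite and repays the precision \<open>|j|\<close> lost in
  \<open>qbinomial_central_congr\<close>.\<close>

lemma tri_ge: "\<bar>a\<bar> - 1 \<le> int (tri a)"
proof -
  have "2 * (\<bar>a\<bar> - 1) \<le> a * (a - 1)"
  proof (cases "a \<ge> 3 \<or> a \<le> 0")
    case True
    thus ?thesis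
    proof
      assume "a \<ge> 3"
      hence "2 * (a - 1) \<le> a * (a - 1)" by (intro mult_right_mono) auto
      thus ?thesis using \<open>a \<ge> 3\<close> by simp
    next
      assume "a \<le> 0"
      hence "0 \<le> a * (a + 1)" by (cases "a = 0") (auto simp: zero_le_mult_iff)
      thus ?thesis using \<open>a \<le> 0\<close> by (simp add: algebra_simps)
    qed
  next
    case False
    hence "a = 1 \<or> a = 2" by auto
    thus ?thesis by auto
  qed
  hence "2 * (\<bar>a\<bar> - 1) \<le> 2 * int (tri a)" by (simp only: tri_double)
  thus ?thesis by simp
qed

text \<open>The limit of \<open>finite_jacobi_derivative\<close> after multiplication by
  \<open>qpoch q n\<close>: each q-binomial times \<open>qpoch q n\<close> tends to 1, and the right
  side becomes a product of three copies of Euler's product.\<close>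

theorem jacobi_cube: "gf UNIV tri (\<lambda>a. alt a * a) = - (euler_fps ^ 3)"
proof (rule fps_ext)
  fix m :: nat
  \<comment> \<open>Large enough that every \<open>j\<close> with \<open>tri j \<le> m\<close> lies
    in \<open>?J\<close> and that index \<open>n - 1\<close> still reaches precision
    \<open>m\<close>.\<close>
  define n where "n = Suc (Suc m)"
  let ?X = "fps_X :: int fps" and ?J = "{- int n..int n}"
  have "congr (?X ^ Suc m) (gf UNIV tri (\<lambda>a. alt a * a)) (\<Sum>j\<in>?J. of_int (alt j * j) * ?X ^ tri j)"
  proof (rule gf_congr_sum)
    fix i assume "tri i < Suc m"
    thus "i \<in> ?J" using tri_ge[of i] by (auto simp: n_def)
  qed auto
  also have "congr (?X ^ Suc m) \<dots> (\<Sum>j\<in>?J. alt j * of_int j * ?X ^ tri j *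
      qbinomial ?X (2 * n) (nat (int n + j)) * qpoch ?X n)"
  proof (rule congr_sum)
    fix j assume j: "j \<in> ?J"
    have "Suc m \<le> tri j + (Suc n - nat \<bar>j\<bar>)"
      using tri_ge[of j] j by (auto simp: n_def)
    from congr_power_mult[OF qbinomial_central_congr[OF j, of ?X] this, of "alt j * of_int j"]
    show "congr (?X ^ Suc m) (of_int (alt j * j) * ?X ^ tri j) (alt j * of_int j * ?X ^ tri j *
      qbinomial ?X (2 * n) (nat (int n + j)) * qpoch ?X n)"
      by (simp add: mult.assoc)
  qed
  also have "(\<Sum>j\<in>?J. alt j * of_int j * ?X ^ tri j *
      qbinomial ?X (2 * n) (nat (int n + j)) * qpoch ?X n) = - (qpoch ?X n * qpoch ?X (n - 1) * qpoch ?X n)"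
    unfolding sum_distrib_right[symmetric] by (subst finite_jacobi_derivative) (auto simp: n_def)
  also have "congr (?X ^ Suc m) \<dots> (- (euler_fps * euler_fps * euler_fps))"
  proof -
    have *: "congr (?X ^ Suc m) (qpoch ?X i) euler_fps" if "i \<ge> m" for i
      by (rule congr_weaken[OF qpoch_fps_X_congr[of i]]) (use that in \<open>auto intro!: le_imp_power_dvd simp del: power_Suc\<close>)
    have "congr (?X ^ Suc m) (- 1 * (qpoch ?X n * qpoch ?X (n - 1) * qpoch ?X n))
       (- 1 * (euler_fps * euler_fps * euler_fps))"
      by (intro congr_mult congr_refl *) (auto simp: n_def)
    thus ?thesis by simp
  qed
  finally show "fps_nth (gf UNIV tri (\<lambda>a. alt a * a)) m = fps_nth (- (euler_fps ^ 3)) m"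
    unfolding congr_fps_X_power by (simp add: power3_eq_cube)
qed

text \<open>The generalized pentagonal number a (3 a - 1) / 2, written as the exponent that the
  triple product yields at base \<open>q ^ 3\<close> and \<open>x = q\<close>.\<close>

definition pent :: "int \<Rightarrow> nat" where
  "pent a = nat (3 * int (tri a) + a)"

lemma int_pent: "int (pent a) = 3 * int (tri a) + a"
proof -
  have "0 \<le> a * (3 * a - 1)" by (cases "a \<le> 0") (auto simp: zero_le_mult_iff)
  also have "\<dots> = 2 * (3 * int (tri a) + a)" using tri_double[of a] by (simp add: algebra_simps)
  finally show ?thesis by (simp add: pent_def)
qed

text \<open>The triple product with \<open>q\<close> replaced by \<open>q ^ 3\<close> and \<open>x = q\<close>.\<close>

theorem pentagonal: "gf UNIV pent alt = euler_fps"
proof (rule fps_ext)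
  fix m :: nat
  define n where "n = Suc (Suc m)"
  let ?X = "fps_X :: int fps" and ?J = "{- int n..int n}"
  let ?B = "\<lambda>j. qbinomial (?X ^ 3) (2 * n) (nat (int n + j))"
  have "congr (?X ^ Suc m) (gf UNIV pent alt) (\<Sum>j\<in>?J. of_int (alt j) * ?X ^ pent j)"
  proof (rule gf_congr_sum)
    fix i assume "pent i < Suc m"
    thus "i \<in> ?J" using tri_ge[of i] int_pent[of i] by (auto simp: n_def)
  qed auto
  \<comment> \<open>The finite triple product carries \<open>x ^ (n + j)\<close> rather than
    \<open>x ^ j\<close>, so the whole comparison is shifted by \<open>?X ^ n\<close>, to be
    cancelled at the end.\<close>
  hence "congr (?X ^ (n + Suc m)) (?X ^ n * gf UNIV pent alt) (?X ^ n * (\<Sum>j\<in>?J. of_int (alt j) * ?X ^ pent j))"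
    unfolding congr_def power_add right_diff_distrib[symmetric] by (rule mult_dvd_mono[OF dvd_refl])
  also have "?X ^ n * (\<Sum>j\<in>?J. of_int (alt j) * ?X ^ pent j) = (\<Sum>j\<in>?J. alt j * (?X ^ (n + pent j)))"
    by (simp add: sum_distrib_left power_add mult_ac)
  also have "congr (?X ^ (n + Suc m)) \<dots> (\<Sum>j\<in>?J. alt j * (?X ^ (n + pent j) * (?B j * qpoch (?X ^ 3) n)))"
  proof (rule congr_sum)
    fix j assume j: "j \<in> ?J"
    have "n + Suc m \<le> n + pent j + 3 * (Suc n - nat \<bar>j\<bar>)"
      using tri_ge[of j] j int_pent[of j] by (auto simp: n_def)
    moreover have "congr (?X ^ (3 * (Suc n - nat \<bar>j\<bar>))) (?B j * qpoch (?X ^ 3) n) 1"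
      using qbinomial_central_congr[OF j, of "?X ^ 3"] by (simp add: power_mult)
    ultimately show "congr (?X ^ (n + Suc m)) (alt j * (?X ^ (n + pent j)))
      (alt j * (?X ^ (n + pent j) * (?B j * qpoch (?X ^ 3) n)))"
      by (intro congr_power_mult)
  qed
  also have "(\<Sum>j\<in>?J. alt j * (?X ^ (n + pent j) * (?B j * qpoch (?X ^ 3) n)))
     = (\<Sum>j\<in>?J. alt j * (?X ^ 3) ^ tri j * ?B j * ?X ^ nat (int n + j)) * qpoch (?X ^ 3) n"
    unfolding sum_distrib_right
  proof (intro sum.cong refl)
    fix j assume j: "j \<in> ?J"
    have "n + pent j = 3 * tri j + nat (int n + j)" using int_pent[of j] j by auto
    hence "?X ^ (n + pent j) = (?X ^ 3) ^ tri j * ?X ^ nat (int n + j)"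
      by (simp add: power_add power_mult)
    thus "alt j * (?X ^ (n + pent j) * (?B j * qpoch (?X ^ 3) n)) =
      alt j * (?X ^ 3) ^ tri j * ?B j * ?X ^ nat (int n + j) * qpoch (?X ^ 3) n"
      by (simp only: mult_ac)
  qed
  also have "\<dots> = (-1) ^ n * ((\<Prod>i<n. ((?X ^ 3) ^ Suc i - ?X) * (1 - ?X * (?X ^ 3) ^ i)) * qpoch (?X ^ 3) n)"
    by (subst finite_jacobi_triple_centred) (auto simp flip: mult.assoc power_mult_distrib)
  \<comment> \<open>The two factors at \<open>i\<close> and the matching factor of
    \<open>qpoch (?X ^ 3) n\<close> supply the exponents 2, 1 and 0 modulo 3, which interleave to
    \<open>qpoch ?X (3 * n)\<close>.\<close>
  also have "(\<Prod>i<n. ((?X ^ 3) ^ Suc i - ?X) * (1 - ?X * (?X ^ 3) ^ i)) * qpoch (?X ^ 3) n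
    = (-1) ^ n * ?X ^ n * qpoch ?X (3 * n)" for n
  proof (induction n)
    case (Suc n)
    have three: "3 * Suc n = Suc (Suc (Suc (3 * n)))" by simp
    have q: "qpoch ?X (3 * Suc n) = qpoch ?X (3 * n) * (1 - ?X ^ Suc (3 * n)) * (1 - ?X ^ Suc (Suc (3 * n)))
      * (1 - ?X ^ Suc (Suc (Suc (3 * n))))"
      unfolding three by (simp only: qpoch_Suc)
    have e: "1 - ?X * (?X ^ 3) ^ n = 1 - ?X ^ Suc (3 * n)"
      "(?X ^ 3) ^ Suc n - ?X = - ?X * (1 - ?X ^ Suc (Suc (3 * n)))"
      "1 - (?X ^ 3) ^ Suc n = 1 - ?X ^ Suc (Suc (Suc (3 * n)))"
      unfolding power_mult[symmetric] three by (simp_all only: power_Suc) (simp_all add: algebra_simps)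
    have r: "P * (- x * b * a) * (R * c) = P * R * - x * (a * b * c)"
      "(-1) ^ n * x ^ n * Q * - x * (a * b * c) = (-1) ^ Suc n * x ^ Suc n * (Q * a * b * c)"
      for P Q R a b c x :: "int fps" by (simp_all add: mult_ac)
    show ?case
      unfolding prod.lessThan_Suc qpoch_Suc[of "?X ^ 3"] e r(1) Suc.IH r(2) q ..
  qed simp
  also have "(-1) ^ n * ((-1) ^ n * ?X ^ n * qpoch ?X (3 * n)) = ?X ^ n * qpoch ?X (3 * n)"
    by (simp flip: mult.assoc power_mult_distrib)
  finally have "congr (?X ^ Suc m) (gf UNIV pent alt) (qpoch ?X (3 * n))"
    unfolding congr_def power_add right_diff_distrib[symmetric] by simp
  also have "congr (?X ^ Suc m) (qpoch ?X (3 * n)) euler_fps"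
    by (rule congr_weaken[OF qpoch_fps_X_congr]) (auto intro!: le_imp_power_dvd simp: n_def simp del: power_Suc)
  finally show "fps_nth (gf UNIV pent alt) m = fps_nth euler_fps m"
    unfolding congr_fps_X_power by simp
qed

section \<open>The eighth power of the Euler function\<close>

lemma gf_mult:
  assumes "\<And>n. finite {i\<in>I. e i = n}" "\<And>n. finite {j\<in>J. e' j = n}"
  shows "gf I e c * gf J e' c' = gf (I \<times> J) (\<lambda>(i, j). e i + e' j) (\<lambda>(i, j). c i * c' j)"
proof (rule fps_ext)
  fix n
  let ?A = "\<lambda>k. {i\<in>I. e i = k} \<times> {j\<in>J. e' j = n - k}"
  have "fps_nth (gf I e c * gf J e' c') n = (\<Sum>k=0..n. \<Sum>(i, j)\<in>?A k. c i * c' j)"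
    by (simp add: fps_mult_nth gf_nth sum_product sum.cartesian_product)
  also have "\<dots> = (\<Sum>(k, i, j)\<in>Sigma {0..n} ?A. c i * c' j)"
    by (subst sum.Sigma) (auto simp: assms)
  also have "\<dots> = (\<Sum>(i, j)\<in>{x\<in>I \<times> J. (case x of (i, j) \<Rightarrow> e i + e' j) = n}. c i * c' j)"
    by (rule sum.reindex_bij_witness[where i = "\<lambda>(i, j). (e i, i, j)" and j = snd]) auto
  finally show "fps_nth (gf I e c * gf J e' c') n =
      fps_nth (gf (I \<times> J) (\<lambda>(i, j). e i + e' j) (\<lambda>(i, j). c i * c' j)) n"
    by (simp add: gf_nth)
qed

lemma gf_reindex:
  assumes "\<And>x. x \<in> I \<Longrightarrow> h x \<in> J \<and> g (h x) = x \<and> e' (h x) = e x \<and> c' (h x) = c x"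
    and "\<And>y. y \<in> J \<Longrightarrow> g y \<in> I \<and> h (g y) = y"
  shows "gf I e c = gf J e' c'"
proof (rule fps_ext)
  fix n
  have "e (g y) = e' y" if "y \<in> J" for y using assms that by metis
  thus "fps_nth (gf I e c) n = fps_nth (gf J e' c') n"
    unfolding gf_nth using assms
    by (intro sum.reindex_bij_witness[where i = g and j = h]) auto
qed

lemma gf_uminus: "gf I e (\<lambda>i. - c i) = - gf I e c"
  by (simp add: fps_eq_iff gf_nth sum_negf)

text \<open>A sign-reversing involution makes the series equal to its own negative.\<close>

lemma gf_eq_0:
  assumes "\<And>x. x \<in> I \<Longrightarrow> h x \<in> I \<and> h (h x) = x \<and> e (h x) = e x \<and> c (h x) = - c x"
  shows "gf I e c = 0"
proof -
  have "gf I e c = gf I e (\<lambda>i. - c i)"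
    by (rule gf_reindex[where h = h and g = h]) (use assms in auto)
  thus ?thesis by (simp add: gf_uminus fps_eq_iff)
qed

lemma gf_union:
  assumes "\<And>n. finite {i\<in>I. e i = n}" "\<And>n. finite {i\<in>J. e i = n}" "I \<inter> J = {}"
  shows "gf (I \<union> J) e c = gf I e c + gf J e c"
proof (rule fps_ext)
  fix n
  have "{i \<in> I \<union> J. e i = n} = {i\<in>I. e i = n} \<union> {i\<in>J. e i = n}" by auto
  moreover have "{i\<in>I. e i = n} \<inter> {i\<in>J. e i = n} = {}" using assms(3) by auto
  ultimately show "fps_nth (gf (I \<union> J) e c) n = fps_nth (gf I e c + gf J e c) n"
    by (simp add: gf_nth sum.union_disjoint assms)
qed

lemma finite_tri: "finite {a. tri a = n}"
proof (rule finite_subset)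
  show "{a. tri a = n} \<subseteq> {- int n - 1..int n + 1}"
  proof safe
    fix a
    show "a \<in> {- int (tri a) - 1..int (tri a) + 1}"
      using tri_ge[of a] by auto
  qed
qed simp

lemma finite_pent: "finite {a. pent a = n}"
proof (rule finite_subset)
  show "{a. pent a = n} \<subseteq> {- int n - 3..int n + 3}"
  proof safe
    fix a
    show "a \<in> {- int (pent a) - 3..int (pent a) + 3}"
      using tri_ge[of a] int_pent[of a] by auto
  qed
qed simp

section \<open>Triple sums and the Macdonald identity\<close>

type_synonym triple = "int \<times> int \<times> int"

definition tri3 :: "triple \<Rightarrow> nat" where
  "tri3 = (\<lambda>(a, b, c). tri a + (tri b + tri c))"

definition tgf :: "triple set \<Rightarrow> (int \<Rightarrow> int \<Rightarrow> int \<Rightarrow> int) \<Rightarrow> int fps" where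
  "tgf I f = gf I tri3 (\<lambda>(a, b, c). alt (a + b + c) * f a b c)"

lemma finite_tri3: "finite {x\<in>I. tri3 x = n}"
proof (rule finite_subset)
  let ?A = "\<Union>k\<le>n. {a. tri a = k}"
  show "{x\<in>I. tri3 x = n} \<subseteq> ?A \<times> ?A \<times> ?A" by (auto simp: tri3_def)
  show "finite (?A \<times> ?A \<times> ?A)" by (auto simp: finite_tri)
qed

definition jac :: "nat \<Rightarrow> int fps" where
  "jac k = gf UNIV tri (\<lambda>a. alt a * a ^ k)"

lemma tri_reflect: "tri (1 - a) = tri a"
  by (simp add: tri_def algebra_simps)

text \<open>The reflection \<open>1 - a\<close> preserves \<open>tri\<close> and changes the
  parity.\<close>

lemma jac_0: "jac 0 = 0"
  unfolding jac_def
  by (rule gf_eq_0[where h = "\<lambda>a. 1 - a"]) (auto simp: tri_reflect alt_def)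

lemma jac_1: "jac 1 = - (euler_fps ^ 3)"
  using jacobi_cube by (simp add: jac_def)

lemma tgf_monomial: "tgf UNIV (\<lambda>a b c. a ^ i * b ^ j * c ^ k) = jac i * (jac j * jac k)"
proof -
  have "finite {(a, b). tri a + tri b = n}" for n
  proof (rule finite_subset)
    let ?A = "\<Union>k\<le>n. {a. tri a = k}"
    show "{(a, b). tri a + tri b = n} \<subseteq> ?A \<times> ?A" by auto
    show "finite (?A \<times> ?A)" by (auto simp: finite_tri)
  qed
  thus ?thesis
    unfolding tgf_def jac_def tri3_def
    by (subst gf_mult; (subst gf_mult)?) (auto simp: finite_tri case_prod_unfold alt_add mult_ac)
qed

text \<open>For \<open>\<alpha> = u + v \<omega>\<close> with \<open>\<omega>\<close> a primitive cube root of unity, this is \<open>\<alpha> ^ 3 + cnj \<alpha> ^ 3\<close>,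
  and \<open>eisenstein u v\<close> below is the norm of \<open>\<alpha>\<close>.\<close>

definition macdonald_cubic :: "int \<Rightarrow> int \<Rightarrow> int" where
  "macdonald_cubic u v = (2 * u - v) * (2 * v - u) * (- u - v)"

text \<open>Only the monomial \<open>a * b * c\<close>, with coefficient 12, survives: every other cubic monomial
  misses a variable and therefore contributes a factor \<open>jac 0 = 0\<close>.\<close>

lemma tgf_macdonald: "tgf UNIV (\<lambda>a b c. macdonald_cubic (a - c) (b - c)) = - 12 * euler_fps ^ 9"
proof -
  let ?G = "tgf UNIV"
  let ?m = "\<lambda>i j k a b c :: int. a ^ i * b ^ j * c ^ k"
  have "macdonald_cubic (a - c) (b - c) = 12 * ?m 1 1 1 a b c
    + 2 * (?m 3 0 0 a b c + ?m 0 3 0 a b c + ?m 0 0 3 a b c)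
    - 3 * (?m 2 1 0 a b c + ?m 2 0 1 a b c + ?m 1 2 0 a b c + ?m 0 2 1 a b c + ?m 1 0 2 a b c + ?m 0 1 2 a b c)"
    for a b c
    by (simp add: macdonald_cubic_def algebra_simps power2_eq_square power3_eq_cube)
  hence "?G (\<lambda>a b c. macdonald_cubic (a - c) (b - c)) = fps_const 12 * ?G (?m 1 1 1)
    + fps_const 2 * (?G (?m 3 0 0) + ?G (?m 0 3 0) + ?G (?m 0 0 3))
    - fps_const 3 * (?G (?m 2 1 0) + ?G (?m 2 0 1) + ?G (?m 1 2 0) + ?G (?m 0 2 1) + ?G (?m 1 0 2) + ?G (?m 0 1 2))"
    by (simp only: tgf_def fps_eq_iff gf_nth fps_add_nth fps_sub_nth fps_mult_left_const_nth
        sum_distrib_left sum.distrib[symmetric] sum_subtractf[symmetric] case_prod_unfold)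
       (auto intro!: sum.cong simp: algebra_simps)
  also have "\<dots> = 12 * (jac 1 * (jac 1 * jac 1))"
    unfolding tgf_monomial jac_0 by (simp add: numeral_fps_const)
  also have "\<dots> = - 12 * euler_fps ^ 9"
    unfolding jac_1 by (simp add: power3_eq_cube eval_nat_numeral)
  finally show ?thesis .
qed

text \<open>Diagonal shifts change \<open>a + b + c\<close> by multiples of 3 and so stay within a
  class; the class decides whether the diagonal sum is 0 or pentagonal.\<close>

definition residue_class :: "int \<Rightarrow> triple set" where
  "residue_class r = {(a, b, c). (a + b + c) mod 3 = r}"

lemma tgf_split: "tgf UNIV f = tgf (residue_class 0) f + (tgf (residue_class 1) f + tgf (residue_class 2) f)"
proof -
  have U: "UNIV = residue_class 0 \<union> (residue_class 1 \<union> residue_class 2)"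
    by (auto simp: residue_class_def)
  show ?thesis unfolding tgf_def U
    by (subst gf_union; (intro finite_tri3)?; (subst gf_union)?; (intro finite_tri3)?) (auto simp: residue_class_def)
qed

lemma tri3_double: "2 * int (tri3 (a, b, c)) = a * (a - 1) + b * (b - 1) + c * (c - 1)"
  using tri_double[of a] tri_double[of b] tri_double[of c] by (simp add: tri3_def)

lemma tri3_eqI:
  assumes "a * (a - 1) + b * (b - 1) + c * (c - 1) = a' * (a' - 1) + b' * (b' - 1) + c' * (c' - 1)"
  shows "tri3 (a, b, c) = tri3 (a', b', c')"
proof -
  have "2 * int (tri3 (a, b, c)) = 2 * int (tri3 (a', b', c'))"
    unfolding tri3_double by (rule assms)
  thus ?thesis by simp
qed

text \<open>Reflecting \<open>(a, b, c)\<close> along the diagonal preserves \<open>tri3\<close> and the differences, but flips the sign.\<close>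

lemma tgf_class_0: "tgf (residue_class 0) (\<lambda>a b c. macdonald_cubic (a - c) (b - c)) = 0"
  unfolding tgf_def
proof (rule gf_eq_0)
  \<comment> \<open>For a + b + c = 3 d, a diagonal shift by t changes 2 * \<open>tri3\<close> by t
    (6 d + 3 t - 3), whose nonzero root in t is 1 - 2 d. The sum becomes 3 (1 - d), of opposite
    parity.\<close>
  define h :: "triple \<Rightarrow> triple" where
    "h = (\<lambda>(a, b, c). let t = 1 - 2 * ((a + b + c) div 3) in (a + t, b + t, c + t))"
  fix x assume x0: "x \<in> residue_class 0"
  obtain a b c where x: "x = (a, b, c)" by (cases x)
  obtain d where d: "a + b + c = 3 * d" using x0 by (auto simp: x residue_class_def)
  define t where "t = 1 - 2 * d"
  have a: "a = 3 * d - b - c" using d by simp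
  have d': "a + t + (b + t) + (c + t) = 3 * (1 - d)" using d by (simp add: t_def)
  have h: "h (a, b, c) = (a + t, b + t, c + t)" "h (a + t, b + t, c + t) = (a, b, c)"
    unfolding h_def prod.case d d' by (simp_all add: t_def Let_def)
  have "tri3 (a + t, b + t, c + t) = tri3 (a, b, c)"
    by (rule tri3_eqI) (simp add: a t_def algebra_simps)
  moreover have "alt (3 * (1 - d)) = - (alt (3 * d) :: int)" by (auto simp: alt_def)
  ultimately show "h x \<in> residue_class 0 \<and> h (h x) = x \<and> tri3 (h x) = tri3 x \<and>
     (case h x of (a, b, c) \<Rightarrow> alt (a + b + c) * macdonald_cubic (a - c) (b - c)) =
     - (case x of (a, b, c) \<Rightarrow> alt (a + b + c) * macdonald_cubic (a - c) (b - c))"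
    unfolding x h residue_class_def mem_Collect_eq prod.case d d' by simp
qed

text \<open>Reflecting every coordinate to \<open>1 - a\<close> negates both differences, hence the
  odd cubic, and also flips the sign \<open>alt\<close>; the two changes cancel.\<close>

lemma tgf_class_2: "tgf (residue_class 2) (\<lambda>a b c. macdonald_cubic (a - c) (b - c))
    = tgf (residue_class 1) (\<lambda>a b c. macdonald_cubic (a - c) (b - c))"
  unfolding tgf_def
proof (rule gf_reindex[where h = "\<lambda>(a, b, c). (1 - a, 1 - b, 1 - c)" and g = "\<lambda>(a, b, c). (1 - a, 1 - b, 1 - c)"], goal_cases)
  case (1 x)
  obtain a b c where x: "x = (a, b, c)" by (cases x)
  have "(1 - a + (1 - b) + (1 - c)) mod 3 = 1"
    using 1 unfolding x residue_class_def by (simp) presburger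
  moreover have "alt (1 - a + (1 - b) + (1 - c)) = - (alt (a + b + c) :: int)" by (auto simp: alt_def)
  moreover have "macdonald_cubic (1 - a - (1 - c)) (1 - b - (1 - c)) = - macdonald_cubic (a - c) (b - c)"
    by (simp add: macdonald_cubic_def algebra_simps)
  ultimately show ?case by (simp add: x residue_class_def tri3_def tri_reflect)
next
  case (2 x)
  obtain a b c where x: "x = (a, b, c)" by (cases x)
  have "(1 - a + (1 - b) + (1 - c)) mod 3 = 2"
    using 2 unfolding x residue_class_def by (simp) presburger
  thus ?case by (simp add: x residue_class_def)
qed

section \<open>The norm form and its theta series\<close>

definition eisenstein :: "int \<Rightarrow> int \<Rightarrow> int" where
  "eisenstein u v = u\<^sup>2 - u * v + v\<^sup>2"

lemma eisenstein_bound: "3 * u\<^sup>2 \<le> 4 * eisenstein u v" "3 * v\<^sup>2 \<le> 4 * eisenstein u v"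
proof -
  have "4 * eisenstein u v - 3 * u\<^sup>2 = (2 * v - u)\<^sup>2" "4 * eisenstein u v - 3 * v\<^sup>2 = (2 * u - v)\<^sup>2"
    by (simp_all add: eisenstein_def power2_eq_square algebra_simps)
  thus "3 * u\<^sup>2 \<le> 4 * eisenstein u v" "3 * v\<^sup>2 \<le> 4 * eisenstein u v"
    by (metis zero_le_power2 diff_ge_0_iff_ge)+
qed

lemma finite_eisenstein: "finite {(u, v). eisenstein u v = m}"
proof (rule finite_subset)
  have "\<bar>x\<bar> \<le> 4 * m" if "3 * x\<^sup>2 \<le> 4 * m" for x
  proof -
    have "\<bar>x\<bar> \<le> x\<^sup>2"
      using self_le_power[of "\<bar>x\<bar>" 2] by (cases "x = 0") auto
    thus ?thesis using that by (smt (verit) zero_le_power2)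
  qed
  thus "{(u, v). eisenstein u v = m} \<subseteq> {-4 * m..4 * m} \<times> {-4 * m..4 * m}"
    using eisenstein_bound by (fastforce simp: abs_le_iff)
qed simp

text \<open>As elements \<open>u + v \<omega>\<close> these are the ones congruent to 1 modulo
  \<open>1 - \<omega>\<close>, since \<open>\<omega>\<close> is congruent to 1.\<close>

definition primary :: "(int \<times> int) set" where
  "primary = {(u, v). (u + v) mod 3 = 1}"

definition eis_index :: "int \<times> int \<Rightarrow> nat" where
  "eis_index = (\<lambda>(u, v). nat ((eisenstein u v - 1) div 3))"

text \<open>The norm is (u + v)^2 - 3 u v, hence 1 modulo 3 on \<open>primary\<close>, so the
  division in \<open>eis_index\<close> is exact.\<close>

lemma eis_index: "(u, v) \<in> primary \<Longrightarrow> 3 * int (eis_index (u, v)) + 1 = eisenstein u v"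
proof -
  assume "(u, v) \<in> primary"
  hence "(u + v) mod 3 = 1" by (simp add: primary_def)
  then obtain e where e: "u + v = 3 * e + 1" by (metis mult_div_mod_eq)
  hence v: "v = 3 * e + 1 - u" by simp
  have E: "eisenstein u v = 3 * (3 * e\<^sup>2 + 2 * e - u * v) + 1"
    by (simp add: eisenstein_def v power2_eq_square algebra_simps)
  moreover have "0 \<le> eisenstein u v"
    using eisenstein_bound(1)[of u v] zero_le_power2[of u] by linarith
  ultimately show ?thesis by (simp add: eis_index_def)
qed

definition theta8 :: "int fps" where
  "theta8 = gf primary eis_index (\<lambda>(u, v). macdonald_cubic u v)"

lemma finite_eis_index: "finite {x\<in>primary. eis_index x = n}"
  by (rule finite_subset[OF _ finite_eisenstein[of "3 * int n + 1"]]) (auto dest: eis_index)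

text \<open>With s = a + b + c and N the norm at u = a - c, v = b - c, one has 3 (a^2 + b^2 + c^2) =
  s^2 + 2 N. For s = 3 d + 1 this splits \<open>tri3\<close> into \<open>pent d\<close> plus (N - 1)
  / 3, so the sums over d and over (u, v) separate.\<close>

lemma tgf_class_1: "tgf (residue_class 1) (\<lambda>a b c. macdonald_cubic (a - c) (b - c)) = - (euler_fps * theta8)"
proof -
  have "tgf (residue_class 1) (\<lambda>a b c. macdonald_cubic (a - c) (b - c)) =
    gf (UNIV \<times> primary) (\<lambda>(i, j). pent i + eis_index j) (\<lambda>x. - (case x of (i, j) \<Rightarrow> alt i * (case j of (u, v) \<Rightarrow> macdonald_cubic u v)))"
    unfolding tgf_def
  \<comment> \<open>The inverse recovers \<open>c\<close> from u + v = s - 3 c with s = 3 d + 1;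
    flooring division by 3 absorbs the remainder 1.\<close>
  proof (rule gf_reindex[where h = "\<lambda>(a, b, c). ((a + b + c) div 3, a - c, b - c)"
        and g = "\<lambda>(d, u, v). let c = d - (u + v) div 3 in (u + c, v + c, c)"], goal_cases)
    case (1 x)
    obtain a b c where x: "x = (a, b, c)" by (cases x)
    have "(a + b + c) mod 3 = 1" using 1 by (simp add: x residue_class_def)
    then obtain d where d: "a + b + c = 3 * d + 1" by (metis mult_div_mod_eq)
    hence a: "a = 3 * d + 1 - b - c" by simp
    have uv: "a - c + (b - c) = 3 * (d - c) + 1" using d by simp
    have P: "(a - c, b - c) \<in> primary"
      unfolding primary_def mem_Collect_eq prod.case uv by presburger
    have "6 * (int (pent d) + int (eis_index (a - c, b - c))) = 6 * int (tri3 (a, b, c))"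
      using eis_index[OF P] tri_double[of d] tri3_double[of a b c]
      by (simp add: int_pent eisenstein_def a power2_eq_square algebra_simps)
    hence "int (pent d + eis_index (a - c, b - c)) = int (tri3 (a, b, c))" by simp
    hence "pent d + eis_index (a - c, b - c) = tri3 (a, b, c)" by (simp only: of_nat_eq_iff)
    moreover have "alt (3 * d + 1) = - (alt d :: int)" by (auto simp: alt_def)
    moreover have "(3 * d + 1) div 3 = d" "(3 * (d - c) + 1) div 3 = d - c" by auto
    ultimately show ?case using P by (simp add: x d uv Let_def)
  next
    case (2 y)
    obtain d u v where y: "y = (d, u, v)" by (cases y)
    have "(u + v) mod 3 = 1" using 2 by (simp add: y primary_def)
    then obtain e where e: "u + v = 3 * e + 1" by (metis mult_div_mod_eq)
    have "(3 * e + 1) div 3 = e" by auto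
    moreover have "u + (d - e) + (v + (d - e)) + (d - e) = 3 * d + 1" using e by simp
    moreover have "(3 * d + 1) div 3 = d" by auto
    ultimately show ?case by (simp add: y e Let_def residue_class_def)
  qed
  also have "\<dots> = - (gf UNIV pent alt * theta8)"
    unfolding gf_uminus theta8_def by (subst gf_mult) (use finite_pent finite_eis_index in auto)
  finally show ?thesis by (simp add: pentagonal)
qed

text \<open>Class 0 contributes nothing and the other two contribute equally; the common factor
  \<open>- 2 * euler_fps\<close> is then cancelled in the integral domain of power series.\<close>

theorem euler_power_8: "6 * euler_fps ^ 8 = theta8"
proof -
  have "- 12 * euler_fps ^ 9 = - 2 * (euler_fps * theta8)"
    unfolding tgf_macdonald[symmetric] tgf_split[of "\<lambda>a b c. macdonald_cubic (a - c) (b - c)"]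
      tgf_class_0 tgf_class_2 tgf_class_1 by simp
  hence "(- 2 * euler_fps) * (6 * euler_fps ^ 8) = (- 2 * euler_fps) * theta8"
    by (simp add: eval_nat_numeral)
  thus ?thesis by (subst (asm) mult_cancel_left) simp
qed

section \<open>Bipartitions modulo 5\<close>

definition partitions_in :: "nat set \<Rightarrow> nat multiset set" where
  "partitions_in S = {\<alpha>. set_mset \<alpha> \<subseteq> S}"

definition pgf :: "nat set \<Rightarrow> int fps" where
  "pgf S = gf (partitions_in S) sum_mset (\<lambda>_. 1)"

lemma part_le_sum_mset: "x \<in># \<alpha> \<Longrightarrow> x \<le> sum_mset \<alpha>" for \<alpha> :: "nat multiset"
  by (metis insert_DiffM le_add1 sum_mset.add_mset)

lemma finite_partitions: "finite {\<alpha>. is_partition \<alpha> \<and> sum_mset \<alpha> = n}"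
proof (rule finite_subset)
  show "{\<alpha>. is_partition \<alpha> \<and> sum_mset \<alpha> = n} \<subseteq> mset ` {xs. set xs \<subseteq> {..n} \<and> length xs \<le> n}"
  proof safe
    fix \<alpha> assume \<alpha>: "is_partition \<alpha>"
    obtain xs where xs: "\<alpha> = mset xs" by (metis ex_mset)
    have "set xs \<subseteq> {..sum_mset \<alpha>}" using part_le_sum_mset[of _ \<alpha>] by (auto simp: xs)
    moreover have "length xs \<le> sum_mset \<alpha>" using size_le_sum_mset[OF \<alpha>] by (simp add: xs)
    ultimately show "\<alpha> \<in> mset ` {xs. set xs \<subseteq> {..sum_mset \<alpha>} \<and> length xs \<le> sum_mset \<alpha>}"
      unfolding xs by blast
  qed
qed (intro finite_imageI finite_lists_length_le finite_atMost)

lemma finite_partitions_in: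
  assumes "0 \<notin> S" "I \<subseteq> partitions_in S"
  shows "finite {\<alpha>\<in>I. sum_mset \<alpha> = n}"
proof (rule finite_subset[OF _ finite_partitions[of n]], safe)
  fix \<alpha> assume "\<alpha> \<in> I"
  hence "set_mset \<alpha> \<subseteq> S" using assms(2) by (auto simp: partitions_in_def)
  thus "is_partition \<alpha>" using assms(1) by (auto simp: is_partition_def intro!: Nat.gr0I)
qed

text \<open>Removing one copy of \<open>a\<close> maps the partitions containing \<open>a\<close>
  bijectively onto all partitions with parts in \<open>insert a S\<close>.\<close>

lemma pgf_insert:
  assumes "a \<notin> S" "a > 0" "0 \<notin> S"
  shows "pgf (insert a S) * (1 - fps_X ^ a) = pgf S"
proof -
  let ?I = "partitions_in (insert a S)" and ?U = "UNIV :: unit set"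
  let ?J = "{\<alpha>\<in>?I. a \<in># \<alpha>}"
  have 0: "0 \<notin> insert a S" using assms by auto
  have "?I = partitions_in S \<union> ?J"
    unfolding partitions_in_def by auto
  hence "pgf (insert a S) = gf (partitions_in S \<union> ?J) sum_mset (\<lambda>_. 1)"
    by (simp add: pgf_def)
  also have "\<dots> = pgf S + gf ?J sum_mset (\<lambda>_. 1)"
    unfolding pgf_def
  proof (rule gf_union)
    show "finite {\<alpha>\<in>partitions_in S. sum_mset \<alpha> = n}" "finite {\<alpha>\<in>?J. sum_mset \<alpha> = n}" for n
      by (rule finite_partitions_in[OF 0]; auto simp: partitions_in_def)+
  qed (use assms in \<open>auto simp: partitions_in_def\<close>)
  \<comment> \<open>The one-point index set represents the monomial \<open>fps_X ^ a\<close> as a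
    \<open>gf\<close>, so that \<open>gf_mult\<close> applies.\<close>
  also have "gf ?J sum_mset (\<lambda>_. 1) = gf (?U \<times> ?I) (\<lambda>(u, \<alpha>). a + sum_mset \<alpha>) (\<lambda>(u, \<alpha>). 1 * 1)"
    by (rule gf_reindex[where h = "\<lambda>\<alpha>. ((), \<alpha> - {#a#})" and g = "\<lambda>(u, \<alpha>). add_mset a \<alpha>"])
       (auto simp: partitions_in_def dest: in_diffD simp flip: sum_mset.add_mset)
  also have "\<dots> = gf ?U (\<lambda>_. a) (\<lambda>_. 1) * pgf (insert a S)"
    unfolding pgf_def by (subst gf_mult) (auto intro: finite_partitions_in[OF 0])
  also have "gf ?U (\<lambda>_. a) (\<lambda>_. 1) = fps_X ^ a"
    by (auto simp: fps_eq_iff gf_nth)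
  finally show ?thesis by (simp add: algebra_simps)
qed

lemma pgf_product:
  assumes "finite S" "0 \<notin> S"
  shows "pgf S * (\<Prod>a\<in>S. 1 - fps_X ^ a) = 1"
  using assms
proof (induction S rule: finite_induct)
  case empty
  have "{\<alpha>\<in>partitions_in {}. sum_mset \<alpha> = n} = (if n = 0 then {{#}} else {})" for n
    by (auto simp: partitions_in_def)
  thus ?case by (simp add: pgf_def fps_eq_iff gf_nth)
next
  case (insert a S)
  hence "pgf (insert a S) * (1 - fps_X ^ a) = pgf S" by (intro pgf_insert) auto
  thus ?case using insert by (simp flip: mult.assoc)
qed

section \<open>The generating function of 5-regular partitions\<close>

definition regular_gf :: "int fps" where
  "regular_gf = gf {\<alpha>. regular_partition 5 \<alpha>} sum_mset (\<lambda>_. 1)"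

lemma regular_gf_square: "fps_nth (regular_gf ^ 2) n = int (B5 n)"
proof -
  have fin: "finite {\<alpha> \<in> {\<alpha>. regular_partition 5 \<alpha>}. sum_mset \<alpha> = n}" for n
    by (rule finite_subset[OF _ finite_partitions[of n]]) (auto simp: regular_partition_def)
  have "fps_nth (regular_gf ^ 2) n = (\<Sum>x\<in>regular_bipartitions 5 n. 1)"
    unfolding power2_eq_square regular_gf_def gf_mult[OF fin fin] gf_nth
    by (intro sum.cong) (auto simp: regular_bipartitions_def)
  thus ?thesis by (simp add: B5_def)
qed

text \<open>The bound \<open>5 * n\<close> leaves out exactly the multiples 5, 10, ..., 5 n, so that
  \<open>qpoch fps_X (5 * n)\<close> factors with cofactor
  \<open>qpoch (fps_X ^ 5) n\<close>.\<close>

definition regular_parts :: "nat \<Rightarrow> nat set" where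
  "regular_parts n = {a\<in>{1..5 * n}. \<not> 5 dvd a}"

lemma regular_gf_congr: "congr (fps_X ^ Suc n) regular_gf (pgf (regular_parts n))"
  unfolding congr_fps_X_power
proof safe
  fix i assume i: "i < Suc n"
  have "{\<alpha> \<in> {\<alpha>. regular_partition 5 \<alpha>}. sum_mset \<alpha> = i} = {\<alpha>\<in>partitions_in (regular_parts n). sum_mset \<alpha> = i}"
    using part_le_sum_mset i
    by (fastforce simp: regular_partition_def is_partition_def partitions_in_def regular_parts_def Suc_le_eq)
  thus "fps_nth regular_gf i = fps_nth (pgf (regular_parts n)) i"
    by (simp add: regular_gf_def pgf_def gf_nth)
qed

lemma pgf_regular_parts: "pgf (regular_parts n) * qpoch fps_X (5 * n) = qpoch (fps_X ^ 5) n"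
proof -
  let ?M = "(\<lambda>i. 5 * Suc i) ` {..<n}"
  have q: "qpoch x m = (\<Prod>a\<in>{1..m}. 1 - x ^ a)" for x :: "int fps" and m
    unfolding qpoch_def by (rule prod.reindex_bij_witness[of _ "\<lambda>a. a - 1" Suc]) auto
  have U: "{1..5 * n} = regular_parts n \<union> ?M"
  proof (intro equalityI subsetI)
    fix a assume a: "a \<in> {1..5 * n}"
    show "a \<in> regular_parts n \<union> ?M"
    proof (cases "5 dvd a")
      case True
      then obtain b where b: "a = 5 * b" by blast
      with a have "a = 5 * Suc (b - 1)" "b - 1 < n" by auto
      thus ?thesis by blast
    qed (use a in \<open>auto simp: regular_parts_def\<close>)
  qed (auto simp: regular_parts_def)
  have "qpoch fps_X (5 * n) = (\<Prod>a\<in>regular_parts n. 1 - fps_X ^ a :: int fps) * (\<Prod>a\<in>?M. 1 - fps_X ^ a)"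
    unfolding q U by (rule prod.union_disjoint) (auto simp: regular_parts_def)
  also have "(\<Prod>a\<in>?M. 1 - fps_X ^ a :: int fps) = qpoch (fps_X ^ 5) n"
    by (subst prod.reindex) (auto simp: inj_on_def qpoch_def power_mult[symmetric] simp del: power_Suc)
  finally have "pgf (regular_parts n) * qpoch fps_X (5 * n) =
      (pgf (regular_parts n) * (\<Prod>a\<in>regular_parts n. 1 - fps_X ^ a)) * qpoch (fps_X ^ 5) n"
    by (simp add: mult_ac)
  thus ?thesis by (subst (asm) pgf_product) (auto simp: regular_parts_def)
qed

lemma qpoch_frobenius: "congr 5 (qpoch (q ^ 5) n) (qpoch q n ^ 5)"
proof -
  have "congr 5 (1 - x ^ 5) ((1 - x) ^ 5)" for x :: 'a
  proof -
    have "(1 - x ^ 5) - (1 - x) ^ 5 = 5 * (x - 2 * x ^ 2 + 2 * x ^ 3 - x ^ 4)"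
      by (simp add: eval_nat_numeral algebra_simps)
    thus ?thesis unfolding congr_def by (metis dvd_triv_left)
  qed
  hence "congr 5 (1 - (q ^ 5) ^ Suc i) ((1 - q ^ Suc i) ^ 5)" for i
    by (metis power_mult mult.commute)
  thus ?thesis unfolding qpoch_def prod_power_distrib by (intro congr_prod)
qed

text \<open>The left product is exactly Euler's product at \<open>q ^ 5\<close>, and
  \<open>qpoch_frobenius\<close> turns that into the fifth power. Coefficient n is compared on
  truncations, where both facts are about finite products.\<close>

lemma regular_gf_euler: "congr (of_int 5) (regular_gf * euler_fps) (euler_fps ^ 5)"
  unfolding congr_of_int_fps
proof
  fix n
  have e: "congr (fps_X ^ Suc n) (qpoch fps_X m) euler_fps" if "n \<le> m" for m
    by (rule congr_weaken[OF qpoch_fps_X_congr[of m]]) (use that in \<open>auto intro!: le_imp_power_dvd simp del: power_Suc\<close>)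
  have "congr (fps_X ^ Suc n) (regular_gf * euler_fps) (pgf (regular_parts n) * qpoch fps_X (5 * n))"
    by (intro congr_mult regular_gf_congr congr_sym[OF e]) auto
  hence 1: "fps_nth (regular_gf * euler_fps) n = fps_nth (qpoch (fps_X ^ 5) n) n"
    unfolding pgf_regular_parts congr_fps_X_power by blast
  have "congr (of_int 5) (qpoch (fps_X ^ 5) n :: int fps) (qpoch fps_X n ^ 5)"
    using qpoch_frobenius[of "fps_X :: int fps" n] by simp
  hence 2: "5 dvd fps_nth (qpoch (fps_X ^ 5) n) n - fps_nth (qpoch fps_X n ^ 5 :: int fps) n"
    unfolding congr_of_int_fps by blast
  have "fps_nth (qpoch fps_X n ^ 5) n = fps_nth (euler_fps ^ 5) n"
    using congr_power[OF e[OF order_refl], of 5] unfolding congr_fps_X_power by blast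
  thus "5 dvd fps_nth (regular_gf * euler_fps) n - fps_nth (euler_fps ^ 5) n"
    using 1 2 by simp
qed

text \<open>Euler's product has constant term 1 and can be cancelled, so \<open>regular_gf\<close>
  is its fourth power modulo 5 and the square its eighth; the factor 6 in
  \<open>euler_power_8\<close> is 1 modulo 5.\<close>

theorem B5_theta8: "5 dvd int (B5 n) - fps_nth theta8 n"
proof -
  obtain g where g: "1 = euler_fps * g"
    using fps_is_left_unit_iff_zeroth_is_left_unit[of euler_fps] by auto
  have "congr (of_int 5) (regular_gf * euler_fps * g) (euler_fps ^ 5 * g)"
    by (intro congr_mult regular_gf_euler congr_refl)
  also have "euler_fps ^ 5 * g = euler_fps ^ 4 * (euler_fps * g)" by (simp add: eval_nat_numeral)
  finally have "congr (of_int 5) regular_gf (euler_fps ^ 4)"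
    by (simp add: mult.assoc flip: g)
  from congr_power[OF this, of 2]
  have "congr (of_int 5) (regular_gf ^ 2) (euler_fps ^ 8)"
    by (simp flip: power_mult)
  also have "congr (of_int 5) (euler_fps ^ 8) theta8"
  proof -
    have "euler_fps ^ 8 - theta8 = of_int 5 * (- (euler_fps ^ 8))"
      unfolding euler_power_8[symmetric] by simp
    thus ?thesis unfolding congr_def by (metis dvd_triv_left)
  qed
  finally show ?thesis unfolding congr_of_int_fps regular_gf_square[symmetric] by blast
qed

section \<open>The Hecke relation at inert primes\<close>

lemma fermat_int:
  fixes a :: int
  assumes "prime p" "\<not> int p dvd a"
  shows "[a ^ (p - 1) = 1] (mod int p)"
proof -
  define b where "b = nat (a mod int p)"
  have p: "int p > 0" using assms(1) prime_gt_0_nat by simp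
  have b: "[int b = a] (mod int p)" using p by (simp add: b_def cong_def)
  have "\<not> p dvd b" using assms(2) b by (metis cong_dvd_iff int_dvd_int_iff)
  hence "[b ^ (p - 1) = 1] (mod p)" using assms(1) by (rule fermat_theorem[rotated])
  hence "[int b ^ (p - 1) = 1] (mod int p)" by (metis cong_int_iff of_nat_1 of_nat_power)
  thus ?thesis using cong_pow[OF b, of "p - 1"] by (meson cong_sym cong_trans)
qed

text \<open>If \<open>p\<close> divides neither variable, (u + v) N = u^3 - (-v)^3 makes the cubes
  of u and -v congruent. As p - 1 is 1 modulo 3, Fermat gives u = -v modulo p, and then (u + v)^2 -
  N = 3 u v forces p = 3, a contradiction.\<close>

lemma eisenstein_inert_dvd:
  assumes "prime p" "p mod 3 = 2" "int p dvd eisenstein u v"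
  shows "int p dvd u \<and> int p dvd v"
proof -
  have P: "prime (int p)" using assms(1) by simp
  have one: "int p dvd b" if "int p dvd a" "int p dvd a\<^sup>2 - a * b + b\<^sup>2" for a b
  proof -
    have "int p dvd (a\<^sup>2 - a * b + b\<^sup>2) - a * (a - b)" using that by (intro dvd_diff) auto
    hence "int p dvd b\<^sup>2" by (simp add: algebra_simps power2_eq_square)
    thus ?thesis using P prime_dvd_power by blast
  qed
  have "int p dvd u \<or> int p dvd v"
  proof (rule ccontr)
    assume "\<not> ?thesis"
    hence nu: "\<not> int p dvd u" and nv: "\<not> int p dvd v" by auto
    define j where "j = p div 3"
    have j: "p - 1 = Suc (3 * j)" using assms(2) by (simp add: j_def) presburger
    have "int p dvd (u + v) * eisenstein u v" using assms(3) by simp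
    also have "(u + v) * eisenstein u v = u ^ 3 - (- v) ^ 3"
      by (simp add: eisenstein_def algebra_simps power2_eq_square power3_eq_cube)
    finally have "[u ^ 3 = (- v) ^ 3] (mod int p)" by (simp add: cong_iff_dvd_diff)
    hence c: "[u ^ (3 * j) = (- v) ^ (3 * j)] (mod int p)"
      unfolding power_mult by (rule cong_pow)
    have "[u ^ Suc (3 * j) = 1] (mod int p)" "[(- v) ^ Suc (3 * j) = 1] (mod int p)"
      using fermat_int[OF assms(1), of u] fermat_int[OF assms(1), of "- v"] nu nv unfolding j by auto
    hence "[u * u ^ (3 * j) = (- v) * (- v) ^ (3 * j)] (mod int p)"
      unfolding power_Suc by (metis cong_sym cong_trans)
    moreover have "[(- v) * (- v) ^ (3 * j) = (- v) * u ^ (3 * j)] (mod int p)"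
      by (intro cong_mult cong_refl cong_sym[OF c])
    ultimately have "[u * u ^ (3 * j) = (- v) * u ^ (3 * j)] (mod int p)" by (rule cong_trans)
    hence "int p dvd (u + v) * u ^ (3 * j)" by (simp add: cong_iff_dvd_diff algebra_simps)
    hence uv: "int p dvd u + v"
      using P nu by (metis prime_dvd_mult_iff prime_dvd_power)
    have "int p dvd (u + v) * (u + v) - eisenstein u v" using uv assms(3) by (intro dvd_diff) auto
    also have "(u + v) * (u + v) - eisenstein u v = 3 * (u * v)"
      by (simp add: eisenstein_def algebra_simps power2_eq_square)
    finally have "int p dvd 3" using nu nv P by (simp add: prime_dvd_mult_iff)
    hence "p dvd 3" by (metis int_dvd_int_iff of_nat_numeral)
    hence "p = 3" using assms(1) primes_dvd_imp_eq[of p 3] by simp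
    thus False using assms(2) by simp
  qed
  thus ?thesis
    using one[of u v] one[of v u] assms(3) by (auto simp: eisenstein_def algebra_simps)
qed

lemma theta8_nth: "fps_nth theta8 n = (\<Sum>(u, v)\<in>{x\<in>primary. case x of (u, v) \<Rightarrow> eisenstein u v = 3 * int n + 1}. macdonald_cubic u v)"
proof -
  have "{x\<in>primary. eis_index x = n} = {x\<in>primary. case x of (u, v) \<Rightarrow> eisenstein u v = 3 * int n + 1}"
    by (auto simp: eis_index[symmetric])
  thus ?thesis by (simp add: theta8_def gf_nth)
qed

text \<open>Multiplication by \<open>- p\<close> preserves \<^const>\<open>primary\<close> because \<open>p\<close> is \<open>2\<close> modulo \<open>3\<close>, and cubes turn
  it into the factor \<open>- (p ^ 3)\<close>.\<close>

lemma theta8_hecke: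
  assumes p: "prime p" "p mod 3 = 2" and m: "3 * m + 1 = p\<^sup>2 * (3 * n + 1)"
  shows "fps_nth theta8 m = - (int p ^ 3) * fps_nth theta8 n"
proof -
  let ?S = "\<lambda>n. {x\<in>primary. case x of (u, v) \<Rightarrow> eisenstein u v = 3 * int n + 1}"
  have p0: "int p > 0" using p(1) prime_gt_0_nat by simp
  have m': "3 * int m + 1 = (int p)\<^sup>2 * (3 * int n + 1)"
    using arg_cong[OF m, of int] by (simp only: of_nat_mult of_nat_add of_nat_power of_nat_1 of_nat_numeral)
  have eis: "eisenstein (- (int p * u)) (- (int p * v)) = (int p)\<^sup>2 * eisenstein u v" for u v
    by (simp add: eisenstein_def algebra_simps power2_eq_square)
  have prim: "(- (int p * u), - (int p * v)) \<in> primary \<longleftrightarrow> (u, v) \<in> primary" for u v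
  proof -
    have "int p mod 3 = 2" using p(2) by (metis of_nat_mod of_nat_numeral)
    then obtain r where r: "int p = 3 * r + 2" by (metis mult_div_mod_eq)
    \<comment> \<open>Here -p = 1 - 3 (r + 1), so multiplication by -p fixes u + v modulo 3.\<close>
    have "- (int p * u) + - (int p * v) = (u + v) + 3 * (- (r + 1) * (u + v))"
      unfolding r by (simp add: algebra_simps)
    thus ?thesis unfolding primary_def mem_Collect_eq prod.case by (simp only: mod_mult_self2)
  qed
  have "fps_nth theta8 m = (\<Sum>(u, v)\<in>?S n. macdonald_cubic (- (int p * u)) (- (int p * v)))"
    unfolding theta8_nth
  \<comment> \<open>Scaling by -p reaches every index: the norm p^2 (3 n + 1) is divisible by p, so
    \<open>eisenstein_inert_dvd\<close> makes both coordinates divisible.\<close>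
  proof (rule sum.reindex_bij_witness[where i = "\<lambda>(u, v). (- (int p * u), - (int p * v))"
        and j = "\<lambda>(u, v). (- (u div int p), - (v div int p))"], goal_cases)
    case (1 x)
    obtain u v where x: "x = (u, v)" by (cases x)
    have "int p dvd eisenstein u v" using 1 by (simp add: x m' power2_eq_square)
    from eisenstein_inert_dvd[OF p this] show ?case by (auto simp: x)
  next
    case (2 x)
    obtain u v where x: "x = (u, v)" by (cases x)
    have "int p dvd eisenstein u v" using 2 by (simp add: x m' power2_eq_square)
    from eisenstein_inert_dvd[OF p this] obtain u' v' where uv: "u = int p * u'" "v = int p * v'"
      unfolding dvd_def by blast
    have "(- (int p * (- u')), - (int p * (- v'))) \<in> primary" using 2 by (simp add: x uv)
    hence "(- u', - v') \<in> primary" unfolding prim .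
    moreover have "(int p)\<^sup>2 * eisenstein (- u') (- v') = (int p)\<^sup>2 * (3 * int n + 1)"
      unfolding eis[symmetric] m'[symmetric] using 2 by (simp add: x uv)
    ultimately show ?case using p0 by (simp add: x uv)
  next
    case (3 y)
    thus ?case using p0 by (auto simp: minus_mult_right simp del: mult_minus_right)
  next
    case (4 y)
    thus ?case by (auto simp: prim eis m')
  next
    case (5 x)
    obtain u v where x: "x = (u, v)" by (cases x)
    have "int p dvd eisenstein u v" using 5 by (simp add: x m' power2_eq_square)
    from eisenstein_inert_dvd[OF p this] show ?case by (auto simp: x)
  qed
  also have "\<dots> = (\<Sum>(u, v)\<in>?S n. - (int p ^ 3) * macdonald_cubic u v)"
    by (intro sum.cong refl) (auto simp: macdonald_cubic_def power3_eq_cube algebra_simps)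
  finally show ?thesis by (simp add: theta8_nth sum_distrib_left case_prod_unfold)
qed

lemma theta8_hecke_power:
  assumes p: "prime p" "p mod 3 = 2" and m: "3 * m + 1 = p ^ (2 * k) * (3 * n + 1)"
  shows "fps_nth theta8 m = (- (int p ^ 3)) ^ k * fps_nth theta8 n"
  using m
proof (induction k arbitrary: n)
  case 0
  thus ?case by simp
next
  case (Suc k)
  obtain r where r: "p = 3 * r + 2" using p(2) by (metis mult_div_mod_eq)
  \<comment> \<open>The coefficient of \<open>3 * n + 1\<close> is (p^2 - 1) / 3 expressed through
    \<open>r\<close>, so that one Hecke step leads from \<open>n\<close> to
    \<open>n'\<close>.\<close>
  define n' where "n' = (3 * r\<^sup>2 + 4 * r + 1) * (3 * n + 1) + n"
  have n': "3 * n' + 1 = p\<^sup>2 * (3 * n + 1)"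
    unfolding n'_def r by (simp add: power2_eq_square algebra_simps)
  have "3 * m + 1 = p ^ (2 * k) * (3 * n' + 1)"
    unfolding Suc.prems n' by (simp add: power2_eq_square algebra_simps)
  from Suc.IH[OF this] theta8_hecke[OF p n'] show ?case by simp
qed

theorem corollary1p13:
  fixes k p n :: nat
  assumes "k \<ge> 1" and "prime p" and "[p = 2] (mod 3)"
  shows "[int (B5 (p ^ (2 * k) * n + (p ^ (2 * k) - 1) div 3)) = (- (int p ^ 3)) ^ k * int (B5 n)] (mod 5)"
proof -
  define m where "m = p ^ (2 * k) * n + (p ^ (2 * k) - 1) div 3"
  have p: "p mod 3 = 2" using assms(3) by (simp add: cong_def)
  \<comment> \<open>An even power of \<open>p\<close> is 1 modulo 3, so the division by 3 is exact
    and \<open>3 * m + 1 = p ^ (2 * k) * (3 * n + 1)\<close>.\<close>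
  have "[p ^ (2 * k) = 2 ^ (2 * k)] (mod 3)" by (rule cong_pow[OF assms(3)])
  also have "[2 ^ (2 * k) = 1 ^ k] (mod 3 :: nat)"
    unfolding power_mult by (rule cong_pow) (simp add: cong_def)
  finally have "p ^ (2 * k) mod 3 = 1" by (simp add: cong_def)
  then obtain t where t: "p ^ (2 * k) = 3 * t + 1" by (metis mult_div_mod_eq)
  have "3 * m + 1 = p ^ (2 * k) * (3 * n + 1)"
    unfolding m_def t by (simp add: algebra_simps)
  hence L: "fps_nth theta8 m = (- (int p ^ 3)) ^ k * fps_nth theta8 n"
    by (rule theta8_hecke_power[OF assms(2) p])
  have B: "[int (B5 i) = fps_nth theta8 i] (mod 5)" for i
    using B5_theta8[of i] by (simp add: cong_iff_dvd_diff)
  have "[int (B5 m) = (- (int p ^ 3)) ^ k * fps_nth theta8 n] (mod 5)"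
    using B[of m] unfolding L .
  also have "[(- (int p ^ 3)) ^ k * fps_nth theta8 n = (- (int p ^ 3)) ^ k * int (B5 n)] (mod 5)"
    by (intro cong_mult cong_refl cong_sym[OF B])
  finally show ?thesis unfolding m_def .
qed

end
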